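(* Let $G$ be a topological group acting on a metric space $X$ continuously by isometries, and let $\ast\in X$. Then the affine extension of the action over $B(X,\ast)$ is continuous as well.
   Context: $L(X,\ast)$ is the real vector space having $X\setminus\{\ast\}$ as a Hamel basis and $\ast$ as zero, equipped with the largest seminorm $p$ such that $p(x-y)\le d(x,y)$ for all $x,y\in X$; this $p$ is a norm inducing $d$ on $X$. $B(X,\ast)$ (the Lipschitz-free Banach space) is the Banach space completion of $L(X,\ast)$. Every surjective self-isometry of $X$ (not necessarily fixing $\ast$) extends uniquely to a surjective affine self-isometry of $B(X,\ast)$. If $\tau$ is an action of $G$ on $X$ by isometries, its affine extension is the action $g\mapsto\tilde\tau_g$ of $G$ on $B(X,\ast)$, where $\tilde\tau_g$ is the unique affine self-isometry of $B(X,\ast)$ extending $\tau_g$. An action of $G$ on a metric space $Y$ by isometries is continuous if the map $G\times Y\to Y$ is jointly continuous (equivalently, every orbit map $g\mapsto gy$ is continuous). *)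

theory Defs
  imports "HOL-Analysis.Analysis"
begin

definition seminorm_on :: "'b::real_vector set \<Rightarrow> ('b \<Rightarrow> real) \<Rightarrow> bool" where
  "seminorm_on L q \<longleftrightarrow>
     (\<forall>v\<in>L. 0 \<le> q v) \<and>
     (\<forall>v\<in>L. \<forall>w\<in>L. q (v + w) \<le> q v + q w) \<and>
     (\<forall>c. \<forall>v\<in>L. q (c *\<^sub>R v) = \<bar>c\<bar> * q v)"

definition admissible_seminorm ::
  "('x::metric_space \<Rightarrow> 'b::real_vector) \<Rightarrow> ('b \<Rightarrow> real) \<Rightarrow> bool" where
  "admissible_seminorm \<delta> q \<longleftrightarrow>
     seminorm_on (span (range \<delta>)) q \<and> (\<forall>x y. q (\<delta> x - \<delta> y) \<le> dist x y)"

text \<open>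
  The Lipschitz-free space over the pointed metric space \<open>(X, base)\<close>, described like any
  completion up to isometric isomorphism: the Banach space is the whole type \<open>'b\<close>, and
  \<open>\<delta>\<close> plays the role of the inclusion of \<open>X\<close>.  The first three conjuncts say that
  \<open>L = span (range \<delta>)\<close> has \<open>X - {base}\<close> as a Hamel basis and \<open>base\<close> as zero; the next two say
  that the norm of \<open>'b\<close> is, on \<open>L\<close>, the largest admissible seminorm; the last one says
  that the Banach space \<open>'b\<close> is a completion of \<open>L\<close>.
\<close>
definition lipschitz_free_space ::
  "'x::metric_space \<Rightarrow> ('x \<Rightarrow> 'b::banach) \<Rightarrow> bool" where
  "lipschitz_free_space base \<delta> \<longleftrightarrow>
     \<delta> base = 0 \<and>
     inj_on \<delta> (UNIV - {base}) \<and>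
     independent (\<delta> ` (UNIV - {base})) \<and>
     admissible_seminorm \<delta> norm \<and>
     (\<forall>q. admissible_seminorm \<delta> q \<longrightarrow> (\<forall>v\<in>span (range \<delta>). q v \<le> norm v)) \<and>
     closure (span (range \<delta>)) = UNIV"

definition affine_map :: "('b::real_vector \<Rightarrow> 'c::real_vector) \<Rightarrow> bool" where
  "affine_map T \<longleftrightarrow>
     (\<forall>v w t. T ((1 - t) *\<^sub>R v + t *\<^sub>R w) = (1 - t) *\<^sub>R T v + t *\<^sub>R T w)"

definition is_affine_extension ::
  "('x \<Rightarrow> 'b::real_normed_vector) \<Rightarrow> ('x \<Rightarrow> 'x) \<Rightarrow> ('b \<Rightarrow> 'b) \<Rightarrow> bool" where
  "is_affine_extension \<delta> f T \<longleftrightarrow>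
     affine_map T \<and> surj T \<and> (\<forall>v w. dist (T v) (T w) = dist v w) \<and>
     (\<forall>x. T (\<delta> x) = \<delta> (f x))"

text \<open>
  Meaningful when \<open>f\<close> is a surjective isometry and \<open>lipschitz_free_space base \<delta>\<close>
  holds: the extension then exists and is unique.
\<close>
definition affine_extension ::
  "('x \<Rightarrow> 'b::real_normed_vector) \<Rightarrow> ('x \<Rightarrow> 'x) \<Rightarrow> 'b \<Rightarrow> 'b" where
  "affine_extension \<delta> f = (THE T. is_affine_extension \<delta> f T)"

text \<open>
  Topological groups are those of the class \<open>topological_group_add\<close>: the operation is
  written additively, but is not assumed to be commutative (nor the topology Hausdorff).
\<close>
definition isometric_action ::
  "('g::group_add \<Rightarrow> 'y::metric_space \<Rightarrow> 'y) \<Rightarrow> bool" where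
  "isometric_action \<tau> \<longleftrightarrow>
     (\<forall>y. \<tau> 0 y = y) \<and>
     (\<forall>g h y. \<tau> (g + h) y = \<tau> g (\<tau> h y)) \<and>
     (\<forall>g y z. dist (\<tau> g y) (\<tau> g z) = dist y z)"

definition continuous_isometric_action ::
  "('g::topological_group_add \<Rightarrow> 'y::metric_space \<Rightarrow> 'y) \<Rightarrow> bool" where
  "continuous_isometric_action \<tau> \<longleftrightarrow>
     isometric_action \<tau> \<and> continuous_on UNIV (\<lambda>(g, y). \<tau> g y)"

end

theory Submission
  imports Defs
begin

text \<open>
  The key is a universal property of the Lipschitz-free space: every nonexpansive self-map
  \<open>f\<close> of \<open>X\<close> has exactly one nonexpansive affine lift to \<open>'b\<close>, that is, a nonexpansive affine
  map carrying \<open>\<delta> x\<close> to \<open>\<delta> (f x)\<close>. Uniqueness holds because the points \<open>\<delta> x\<close>, among which is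
  \<open>0\<close>, span a dense subspace. For existence, the Hamel basis gives a linear map \<open>S\<close> with
  \<open>S (\<delta> x) = \<delta> (f x) - \<delta> (f base)\<close>. The seminorm \<open>v \<mapsto> \<parallel>S v\<parallel>\<close> is admissible, so it is at most the
  norm by maximality of the latter; hence the affine map \<open>v \<mapsto> S v + \<delta> (f base)\<close> is
  nonexpansive on the span and extends to the completion.

  Uniqueness makes lifting functorial. For an isometric action, the lifts of \<open>g\<close> and \<open>- g\<close> are
  therefore mutually inverse nonexpansive maps, that is, surjective isometries. So the lifts are
  the affine extensions, and they form an isometric action.

  For continuity, the orbit map of \<open>\<delta> x\<close> is continuous because \<open>\<delta>\<close> is nonexpansive. Since all
  maps are affine, the orbit map of any vector in the span of these points is an algebraic
  combination of such maps. As the family of all lifts is equicontinuous, continuity of the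
  orbit maps on a dense set already gives joint continuity.
\<close>

section \<open>Affine maps\<close>

lemma affine_map_combination:
  assumes "affine_map T"
  shows "T (c *\<^sub>R v + w) = c *\<^sub>R T v + T w - c *\<^sub>R T 0"
proof -
  have aff: "T ((1 - t) *\<^sub>R x + t *\<^sub>R y) = (1 - t) *\<^sub>R T x + t *\<^sub>R T y" for x y t
    using assms unfolding affine_map_def by blast
  have scale: "T (t *\<^sub>R x) = t *\<^sub>R T x + (1 - t) *\<^sub>R T 0" for t x
    using aff[of t 0 x] by (simp add: add.commute)
  \<comment> \<open>A sum is the midpoint of the doubled summands.\<close>
  have "T (c *\<^sub>R v + w) = (1/2) *\<^sub>R T ((2 * c) *\<^sub>R v) + (1/2) *\<^sub>R T (2 *\<^sub>R w)"
    using aff[of "1/2" "(2 * c) *\<^sub>R v" "2 *\<^sub>R w"] by simp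
  also have "\<dots> = c *\<^sub>R T v + T w - c *\<^sub>R T 0"
    unfolding scale by (simp add: algebra_simps flip: scaleR_add_left)
  finally show ?thesis .
qed

lemma affine_map_compose:
  assumes "affine_map T" "affine_map U"
  shows "affine_map (T \<circ> U)"
  using assms by (simp add: affine_map_def)

lemma affine_map_eq_on_span:
  assumes "affine_map T" "affine_map U" "T 0 = U 0" "\<And>b. b \<in> B \<Longrightarrow> T b = U b"
    and "v \<in> span B"
  shows "T v = U v"
  using assms(5)
  by (induction rule: span_induct_alt)
    (simp_all add: assms(3,4) affine_map_combination[OF assms(1)]
      affine_map_combination[OF assms(2)])

text \<open>
  For fixed \<open>t\<close>, the affinity equation defines a closed set of pairs of points, so it passes from
  the pairs in \<open>V\<close> to all pairs.
\<close>
lemma affine_map_closure: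
  fixes T :: "'b::real_normed_vector \<Rightarrow> 'c::real_normed_vector"
  assumes "linear S" "\<And>v. v \<in> V \<Longrightarrow> T v = S v + a"
    and "subspace V" "closure V = UNIV" "continuous_on UNIV T"
  shows "affine_map T"
  unfolding affine_map_def
proof (intro allI)
  fix v w :: 'b and t :: real
  let ?E = "{p. T ((1 - t) *\<^sub>R fst p + t *\<^sub>R snd p) = (1 - t) *\<^sub>R T (fst p) + t *\<^sub>R T (snd p)}"
  have "closed ?E"
    by (intro closed_Collect_eq continuous_intros continuous_on_compose2[OF assms(5)]) auto
  moreover have "V \<times> V \<subseteq> ?E"
  proof clarify
    fix x y assume "x \<in> V" "y \<in> V"
    then have "(1 - t) *\<^sub>R x + t *\<^sub>R y \<in> V"
      using assms(3) by (intro subspace_add subspace_scale)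
    then show "T ((1 - t) *\<^sub>R fst (x, y) + t *\<^sub>R snd (x, y))
        = (1 - t) *\<^sub>R T (fst (x, y)) + t *\<^sub>R T (snd (x, y))"
      using assms(2)[of "(1 - t) *\<^sub>R x + t *\<^sub>R y"] assms(2)[OF \<open>x \<in> V\<close>] assms(2)[OF \<open>y \<in> V\<close>]
      by (simp add: linear_add[OF assms(1)] linear_scale[OF assms(1)] scaleR_add_right
          flip: scaleR_add_left)
  qed
  ultimately have "closure (V \<times> V) \<subseteq> ?E"
    by (rule closure_minimal[rotated])
  moreover have "(v, w) \<in> closure (V \<times> V)"
    by (simp add: closure_Times assms(4))
  ultimately have "(v, w) \<in> ?E"
    by (rule subsetD)
  then show "T ((1 - t) *\<^sub>R v + t *\<^sub>R w) = (1 - t) *\<^sub>R T v + t *\<^sub>R T w"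
    by simp
qed

section \<open>Nonexpansive affine lifts\<close>

text \<open>
  Compared with \<^const>\<open>is_affine_extension\<close>, isometry is relaxed to nonexpansiveness and
  surjectivity is dropped. Existence and uniqueness can then be proved without inverting the
  map, and the two missing properties follow from functoriality.
\<close>
definition nonexpansive_affine_lift ::
  "('x \<Rightarrow> 'b::real_normed_vector) \<Rightarrow> ('x \<Rightarrow> 'x) \<Rightarrow> ('b \<Rightarrow> 'b) \<Rightarrow> bool" where
  "nonexpansive_affine_lift \<delta> f T \<longleftrightarrow>
     affine_map T \<and> 1-lipschitz_on UNIV T \<and> (\<forall>x. T (\<delta> x) = \<delta> (f x))"

lemma nonexpansive_affine_lift_compose:
  assumes "nonexpansive_affine_lift \<delta> f T" "nonexpansive_affine_lift \<delta> h U"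
  shows "nonexpansive_affine_lift \<delta> (f \<circ> h) (T \<circ> U)"
proof -
  have "(1 * 1)-lipschitz_on UNIV (T \<circ> U)"
    using assms unfolding nonexpansive_affine_lift_def
    by (intro lipschitz_on_compose) (auto intro: lipschitz_on_subset)
  then show ?thesis
    using assms by (simp add: nonexpansive_affine_lift_def affine_map_compose)
qed

lemma nonexpansive_affine_lift_id: "nonexpansive_affine_lift \<delta> (\<lambda>x. x) (\<lambda>v. v)"
  by (simp add: nonexpansive_affine_lift_def affine_map_def lipschitz_on_def)

lemma is_affine_extension_imp_lift:
  "is_affine_extension \<delta> f T \<Longrightarrow> nonexpansive_affine_lift \<delta> f T"
  by (simp add: is_affine_extension_def nonexpansive_affine_lift_def lipschitz_on_def)

lemma nonexpansive_affine_lift_unique: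
  assumes free: "lipschitz_free_space base \<delta>"
    and T: "nonexpansive_affine_lift \<delta> f T" and U: "nonexpansive_affine_lift \<delta> f U"
  shows "T = U"
proof
  fix v
  have "\<delta> base = 0"
    using free by (simp add: lipschitz_free_space_def)
  then have T0: "T 0 = U 0"
    using T U unfolding nonexpansive_affine_lift_def by metis
  have "T w = U w" if "w \<in> span (range \<delta>)" for w
  proof (rule affine_map_eq_on_span[OF _ _ _ _ that])
    show "T 0 = U 0" by (rule T0)
  qed (use T U in \<open>auto simp: nonexpansive_affine_lift_def\<close>)
  then have "span (range \<delta>) \<subseteq> {v. T v = U v}"
    by blast
  moreover have "closed {v. T v = U v}"
    using T U by (intro closed_Collect_eq)
      (auto simp: nonexpansive_affine_lift_def intro: lipschitz_on_continuous_on)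
  ultimately have "closure (span (range \<delta>)) \<subseteq> {v. T v = U v}"
    by (rule closure_minimal)
  then show "T v = U v"
    using free by (auto simp: lipschitz_free_space_def)
qed

text \<open>
  The hypothesis says that \<open>v \<mapsto> \<parallel>S v\<parallel>\<close> is an admissible seminorm, and the norm is the largest
  one. This is the only use of maximality.
\<close>
lemma linear_nonexpansive_on_span:
  assumes free: "lipschitz_free_space base \<delta>" and "linear S"
    and "\<And>x y. norm (S (\<delta> x - \<delta> y)) \<le> dist x y"
    and "v \<in> span (range \<delta>)"
  shows "norm (S v) \<le> norm v"
proof -
  have "admissible_seminorm \<delta> (\<lambda>v. norm (S v))"
    using assms(3)
    by (auto simp: admissible_seminorm_def seminorm_on_def linear_add[OF assms(2)]
        linear_scale[OF assms(2)] norm_triangle_ineq)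
  then show ?thesis
    using free assms(4) unfolding lipschitz_free_space_def by blast
qed

lemma nonexpansive_affine_lift_exists:
  fixes f :: "'x::metric_space \<Rightarrow> 'x" and \<delta> :: "'x \<Rightarrow> 'b::banach"
  assumes free: "lipschitz_free_space base \<delta>"
    and f: "\<And>x y. dist (f x) (f y) \<le> dist x y"
  shows "\<exists>T. nonexpansive_affine_lift \<delta> f T"
proof -
  let ?L = "span (range \<delta>)"
  have base: "\<delta> base = 0" and inj: "inj_on \<delta> (UNIV - {base})"
    and indep: "independent (\<delta> ` (UNIV - {base}))"
    and \<delta>: "\<And>x y. norm (\<delta> x - \<delta> y) \<le> dist x y" and dense: "closure ?L = UNIV"
    using free by (auto simp: lipschitz_free_space_def admissible_seminorm_def)
  obtain S where S: "linear S"
    and S_basis: "\<And>b. b \<in> \<delta> ` (UNIV - {base}) \<Longrightarrow>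
      S b = \<delta> (f (inv_into (UNIV - {base}) \<delta> b)) - \<delta> (f base)"
    using linear_independent_extend[OF indep,
        of "\<lambda>b. \<delta> (f (inv_into (UNIV - {base}) \<delta> b)) - \<delta> (f base)"] by blast
  have S_point: "S (\<delta> x) = \<delta> (f x) - \<delta> (f base)" for x
  proof (cases "x = base")
    case True
    then show ?thesis by (simp add: base linear_0[OF S])
  next
    case False
    then show ?thesis using S_basis[of "\<delta> x"] inj by (simp add: inv_into_f_f)
  qed
  have "norm (S (\<delta> x - \<delta> y)) \<le> dist x y" for x y
    using order_trans[OF \<delta> f, of x y] by (simp add: linear_diff[OF S] S_point)
  then have S_norm: "norm (S v) \<le> norm v" if "v \<in> ?L" for v
    using linear_nonexpansive_on_span[OF free S] that by blast
  have "1-lipschitz_on ?L (\<lambda>v. S v + \<delta> (f base))"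
  proof (rule lipschitz_onI)
    fix v w assume "v \<in> ?L" "w \<in> ?L"
    then show "dist (S v + \<delta> (f base)) (S w + \<delta> (f base)) \<le> 1 * dist v w"
      using S_norm[of "v - w"] by (simp add: dist_norm span_diff linear_diff[OF S])
  qed simp
  then obtain T where lip: "1-lipschitz_on UNIV T"
    and T: "\<And>v. v \<in> ?L \<Longrightarrow> T v = S v + \<delta> (f base)"
    using lipschitz_extend_closure[of 1 ?L] dense by metis
  have "affine_map T"
    using affine_map_closure[OF S T subspace_span dense] lip
    by (blast intro: lipschitz_on_continuous_on)
  moreover have "T (\<delta> x) = \<delta> (f x)" for x
    by (simp add: T span_base S_point)
  ultimately show ?thesis
    using lip by (auto simp: nonexpansive_affine_lift_def)
qed

section \<open>The affine extension of an isometric action\<close>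

lemma is_affine_extension_affine_extension:
  assumes free: "lipschitz_free_space base \<delta>" and act: "isometric_action \<tau>"
  shows "is_affine_extension \<delta> (\<tau> g) (affine_extension \<delta> (\<tau> g))"
proof -
  have "\<exists>T. nonexpansive_affine_lift \<delta> (\<tau> h) T" for h
    using act by (intro nonexpansive_affine_lift_exists[OF free]) (simp add: isometric_action_def)
  then obtain T where T: "\<And>h. nonexpansive_affine_lift \<delta> (\<tau> h) (T h)"
    by metis
  have inverse: "T h (T (- h) v) = v" for h v
  proof -
    have "\<tau> h \<circ> \<tau> (- h) = (\<lambda>x. x)"
      using act by (metis comp_apply ext isometric_action_def right_minus)
    then have "nonexpansive_affine_lift \<delta> (\<lambda>x. x) (T h \<circ> T (- h))"
      using nonexpansive_affine_lift_compose[OF T T, of h "- h"] by simp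
    then have "T h \<circ> T (- h) = (\<lambda>v. v)"
      using nonexpansive_affine_lift_unique[OF free _ nonexpansive_affine_lift_id] by blast
    then show ?thesis
      by (metis comp_apply)
  qed
  have shrink: "dist (T h v) (T h w) \<le> dist v w" for h v w
    using T lipschitz_onD[of 1 UNIV "T h" v w] by (auto simp: nonexpansive_affine_lift_def)
  have "dist (T g v) (T g w) = dist v w" for v w
    using shrink[of g v w] shrink[of "- g" "T g v" "T g w"] inverse[of "- g"] by simp
  moreover have "surj (T g)"
    using inverse by (rule surjI)
  ultimately have "is_affine_extension \<delta> (\<tau> g) (T g)"
    using T[of g] by (simp add: is_affine_extension_def nonexpansive_affine_lift_def)
  moreover have "U = T g" if "is_affine_extension \<delta> (\<tau> g) U" for U
    using nonexpansive_affine_lift_unique[OF free is_affine_extension_imp_lift[OF that] T] .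
  ultimately show ?thesis
    unfolding affine_extension_def by (rule theI)
qed

lemma isometric_action_affine_extension:
  assumes free: "lipschitz_free_space base \<delta>" and act: "isometric_action \<tau>"
  shows "isometric_action (\<lambda>g. affine_extension \<delta> (\<tau> g))"
proof -
  let ?T = "\<lambda>g. affine_extension \<delta> (\<tau> g)"
  have ext: "is_affine_extension \<delta> (\<tau> g) (?T g)" for g
    by (rule is_affine_extension_affine_extension[OF free act])
  have lift: "nonexpansive_affine_lift \<delta> (\<tau> g) (?T g)" for g
    by (rule is_affine_extension_imp_lift[OF ext])
  have "\<tau> 0 = (\<lambda>x. x)"
    using act by (auto simp: isometric_action_def)
  then have "?T 0 = (\<lambda>v. v)"
    using nonexpansive_affine_lift_unique[OF free lift[of 0]] nonexpansive_affine_lift_id[of \<delta>]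
    by simp
  moreover have "?T (g + h) = ?T g \<circ> ?T h" for g h
  proof -
    have "\<tau> (g + h) = \<tau> g \<circ> \<tau> h"
      using act by (auto simp: isometric_action_def)
    then show ?thesis
      using nonexpansive_affine_lift_unique[OF free lift[of "g + h"]]
        nonexpansive_affine_lift_compose[OF lift lift, of g h] by simp
  qed
  ultimately show ?thesis
    using ext unfolding isometric_action_def is_affine_extension_def
    by (metis comp_apply)
qed

section \<open>Continuity\<close>

text \<open>
  The isometries of an action are equicontinuous, so moving the point to a nearby one of \<open>D\<close>
  costs the same small error for all group elements.
\<close>
lemma continuous_isometric_action_dense:
  fixes \<tau> :: "'g::topological_group_add \<Rightarrow> 'y::metric_space \<Rightarrow> 'y"
  assumes act: "isometric_action \<tau>" and dense: "closure D = UNIV"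
    and orbit: "\<And>u. u \<in> D \<Longrightarrow> continuous_on UNIV (\<lambda>g. \<tau> g u)"
  shows "continuous_isometric_action \<tau>"
proof -
  have iso: "dist (\<tau> g y) (\<tau> g z) = dist y z" for g y z
    using act by (simp add: isometric_action_def)
  have "((\<lambda>(g, y). \<tau> g y) \<longlongrightarrow> \<tau> h w) (at (h, w))" for h w
  proof (rule tendstoI)
    fix e :: real assume "e > 0"
    then obtain u where u: "u \<in> D" "dist u w < e / 4"
      using dense closure_approachable[of w D] by (metis UNIV_I divide_pos_pos zero_less_numeral)
    have "continuous_on UNIV (\<lambda>p :: 'g \<times> 'y. \<tau> (fst p) u)"
      by (rule continuous_on_compose2[OF orbit[OF u(1)]]) (auto intro: continuous_intros)
    then have "((\<lambda>p. \<tau> (fst p) u) \<longlongrightarrow> \<tau> h u) (at (h, w))"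
      by (auto simp: continuous_on_def)
    then have "\<forall>\<^sub>F p in at (h, w). dist (\<tau> (fst p) u) (\<tau> h u) < e / 4"
      using \<open>e > 0\<close> by (intro tendstoD) auto
    moreover have "\<forall>\<^sub>F p in at (h, w). dist (snd p) w < e / 4"
      using \<open>e > 0\<close> by (intro tendstoD tendsto_eq_intros) auto
    ultimately show "\<forall>\<^sub>F p in at (h, w). dist (case p of (g, y) \<Rightarrow> \<tau> g y) (\<tau> h w) < e"
    proof eventually_elim
      case (elim p)
      obtain g y where p: "p = (g, y)" by force
      \<comment> \<open>The path from \<open>\<tau> g y\<close> to \<open>\<tau> h w\<close> runs through \<open>\<tau> g w\<close>, \<open>\<tau> g u\<close> and \<open>\<tau> h u\<close>.\<close>
      have "dist (\<tau> g y) (\<tau> h w) \<le>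
          dist (\<tau> g y) (\<tau> g w) + dist (\<tau> g w) (\<tau> g u) + dist (\<tau> g u) (\<tau> h u)
          + dist (\<tau> h u) (\<tau> h w)"
        using dist_triangle[of "\<tau> g y" "\<tau> h w" "\<tau> g w"]
          dist_triangle[of "\<tau> g w" "\<tau> h w" "\<tau> g u"]
          dist_triangle[of "\<tau> g u" "\<tau> h w" "\<tau> h u"] by linarith
      also have "\<dots> = dist y w + dist w u + dist (\<tau> g u) (\<tau> h u) + dist u w"
        by (simp add: iso)
      also have "\<dots> < e"
        using elim u(2) by (simp add: p dist_commute[of w u])
      finally show ?case by (simp add: p)
    qed
  qed
  then show ?thesis
    using act by (auto simp: continuous_isometric_action_def continuous_on_def)
qed

theorem proposition5p5:
  fixes \<tau> :: "'g::topological_group_add \<Rightarrow> 'x::metric_space \<Rightarrow> 'x"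
    and base :: 'x
    and \<delta> :: "'x \<Rightarrow> 'b::banach"
  assumes "lipschitz_free_space base \<delta>"
    and "continuous_isometric_action \<tau>"
  shows "continuous_isometric_action (\<lambda>g. affine_extension \<delta> (\<tau> g))"
proof -
  let ?T = "\<lambda>g. affine_extension \<delta> (\<tau> g)"
  have act: "isometric_action \<tau>" and cont: "continuous_on UNIV (\<lambda>(g, y). \<tau> g y)"
    using assms(2) by (auto simp: continuous_isometric_action_def)
  have base: "\<delta> base = 0" and dense: "closure (span (range \<delta>)) = UNIV"
    and \<delta>: "\<And>x y. norm (\<delta> x - \<delta> y) \<le> dist x y"
    using assms(1) by (auto simp: lipschitz_free_space_def admissible_seminorm_def)
  have affine: "affine_map (?T g)" and point: "?T g (\<delta> x) = \<delta> (\<tau> g x)" for g x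
    using is_affine_extension_affine_extension[OF assms(1) act, of g]
    by (auto simp: is_affine_extension_def)
  have "continuous_on UNIV \<delta>"
    using \<delta> by (intro lipschitz_on_continuous_on[of 1] lipschitz_onI) (auto simp: dist_norm)
  moreover have "continuous_on UNIV (\<lambda>g. \<tau> g x)" for x
    using continuous_on_compose2[OF cont, of UNIV "\<lambda>g. (g, x)"]
    by (simp add: continuous_intros)
  ultimately have orbit_point: "continuous_on UNIV (\<lambda>g. ?T g (\<delta> x))" for x
    unfolding point by (rule continuous_on_compose2) auto
  have orbit_0: "continuous_on UNIV (\<lambda>g. ?T g 0)"
    using orbit_point[of base] by (simp add: base)
  have "continuous_on UNIV (\<lambda>g. ?T g v)" if "v \<in> span (range \<delta>)" for v
    using that
  proof (induction rule: span_induct_alt)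
    case base
    show ?case by (rule orbit_0)
  next
    case (step c u v)
    then have "continuous_on UNIV (\<lambda>g. ?T g u)"
      using orbit_point by auto
    then show ?case
      unfolding affine_map_combination[OF affine] using step.IH orbit_0
      by (intro continuous_intros)
  qed
  then show ?thesis
    using isometric_action_affine_extension[OF assms(1) act] dense
    by (intro continuous_isometric_action_dense)
qed

end
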